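(* Let $R$ be a ring, let $\mathbf{C}$ be a based complex of $R$-modules with $C_n = \bigoplus_{\alpha\in I_n} C_\alpha$, and let $M$ be a Morse matching on $\mathbf{C}$. Let $M^0$ be the set of vertices of $\mathcal{G}(\mathbf{C})$ that are not incident to any edge of $M$. Then there is a differential on the graded module $\bigoplus_{\alpha\in M^0} C_\alpha$ (whose degree $n$ part is $\bigoplus_{\alpha\in I_n\cap M^0} C_\alpha$) such that the resulting complex is homotopy equivalent to $\mathbf{C}$.
   Context: Modules are (left or right) modules over a ring $R$; differentials have degree $-1$. A based complex of $R$-modules is a chain complex $\mathbf{C}$ of $R$-modules with differential $d$, together with direct sum decompositions $C_n = \bigoplus_{\alpha\in I_n} C_\alpha$, where $\{I_n\}$ is a family of mutually disjoint index sets. For a graded map $f:\bigoplus_n C_n\to\bigoplus_n C_n$, write $f_{\beta,\alpha}: C_\alpha\to C_\beta$ for the component of $f$ going from $C_\alpha$ to $C_\beta$. The digraph $\mathcal{G}(\mathbf{C})$ has vertex set $V=\bigcup_n I_n$ and a directed edge $\alpha\to\beta$ whenever the component $d_{\beta,\alpha}$ is non-zero. A subset $M$ of the edges of $\mathcal{G}(\mathbf{C})$ such that no vertex is incident to more than one edge of $M$ is called a Morse matching if (i) for each edge $\alpha\to\beta$ in $M$, the component $d_{\beta,\alpha}: C_\alpha\to C_\beta$ is an isomorphism; and (ii) there is a well-founded partial order $\prec$ on each $I_n$ such that $\gamma\prec\alpha$ whenever $\alpha,\gamma\in I_n$ and there is a path $\alpha\to\beta\to\gamma$ in the graph $\mathcal{G}(\mathbf{C})^M$,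 where $\mathcal{G}(\mathbf{C})^M$ is the digraph obtained from $\mathcal{G}(\mathbf{C})$ by reversing the edges from $M$. *)

theory Defs
  imports "HOL-Algebra.Module"
begin

section \<open>Modules over a possibly non-commutative ring\<close>

text \<open>
  The library locale \<^locale>\<open>module\<close> requires a commutative ring. Here left and right modules are
  treated together. For a right module, \<open>a \<odot> x\<close> stands for the product of \<open>x\<close> by \<open>a\<close> on the right.
\<close>

datatype side = Left_Side | Right_Side

locale sided_module = R?: ring R + M?: abelian_group M
  for s :: side and R (structure) and M (structure) +
  assumes smult_closed:
      "\<lbrakk>a \<in> carrier R; x \<in> carrier M\<rbrakk> \<Longrightarrow> a \<odot>\<^bsub>M\<^esub> x \<in> carrier M"
    and smult_l_distr:
      "\<lbrakk>a \<in> carrier R; b \<in> carrier R; x \<in> carrier M\<rbrakk> \<Longrightarrow>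
        (a \<oplus> b) \<odot>\<^bsub>M\<^esub> x = a \<odot>\<^bsub>M\<^esub> x \<oplus>\<^bsub>M\<^esub> b \<odot>\<^bsub>M\<^esub> x"
    and smult_r_distr:
      "\<lbrakk>a \<in> carrier R; x \<in> carrier M; y \<in> carrier M\<rbrakk> \<Longrightarrow>
        a \<odot>\<^bsub>M\<^esub> (x \<oplus>\<^bsub>M\<^esub> y) = a \<odot>\<^bsub>M\<^esub> x \<oplus>\<^bsub>M\<^esub> a \<odot>\<^bsub>M\<^esub> y"
    and smult_assoc:
      "\<lbrakk>a \<in> carrier R; b \<in> carrier R; x \<in> carrier M\<rbrakk> \<Longrightarrow>
        (case s of Left_Side \<Rightarrow> a \<otimes> b | Right_Side \<Rightarrow> b \<otimes> a) \<odot>\<^bsub>M\<^esub> x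
          = a \<odot>\<^bsub>M\<^esub> (b \<odot>\<^bsub>M\<^esub> x)"
    and smult_one:
      "x \<in> carrier M \<Longrightarrow> \<one> \<odot>\<^bsub>M\<^esub> x = x"

lemma (in module) sided_module: "sided_module s R M"
  by unfold_locales
    (auto simp: smult_l_distr smult_r_distr smult_assoc1 R.m_comm split: side.split)

definition lin_maps ::
  "('r, 'q) ring_scheme \<Rightarrow> ('r, 'm) module \<Rightarrow> ('r, 'm) module \<Rightarrow> ('m \<Rightarrow> 'm) set"
where
  "lin_maps R M N =
    {f. f \<in> carrier M \<rightarrow> carrier N \<and>
        (\<forall>x\<in>carrier M. \<forall>y\<in>carrier M. f (x \<oplus>\<^bsub>M\<^esub> y) = f x \<oplus>\<^bsub>N\<^esub> f y) \<and>
        (\<forall>a\<in>carrier R. \<forall>x\<in>carrier M. f (a \<odot>\<^bsub>M\<^esub> x) = a \<odot>\<^bsub>N\<^esub> f x)}"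

definition lin_isos ::
  "('r, 'q) ring_scheme \<Rightarrow> ('r, 'm) module \<Rightarrow> ('r, 'm) module \<Rightarrow> ('m \<Rightarrow> 'm) set"
where
  "lin_isos R M N = {f \<in> lin_maps R M N. bij_betw f (carrier M) (carrier N)}"

abbreviation restrict_to :: "('r, 'm) module \<Rightarrow> 'm set \<Rightarrow> ('r, 'm) module" where
  "restrict_to M H \<equiv> M\<lparr>carrier := H\<rparr>"


section \<open>Internal direct sums\<close>

text \<open>
  \<open>families M J S\<close> is the underlying set of the external direct sum of the submodules \<open>S \<alpha>\<close> of \<open>M\<close>
  for \<open>\<alpha> \<in> J\<close>; such families are extended by zero outside \<open>J\<close>. Since \<^const>\<open>finsum\<close> is only meaningful
  over finite sets, the sum of a family is taken over its support.
\<close>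

definition families :: "('r, 'm) module \<Rightarrow> 'i set \<Rightarrow> ('i \<Rightarrow> 'm set) \<Rightarrow> ('i \<Rightarrow> 'm) set" where
  "families M J S =
    {x. (\<forall>\<alpha>\<in>J. x \<alpha> \<in> S \<alpha>) \<and> (\<forall>\<alpha>. \<alpha> \<notin> J \<longrightarrow> x \<alpha> = \<zero>\<^bsub>M\<^esub>) \<and> finite {\<alpha>. x \<alpha> \<noteq> \<zero>\<^bsub>M\<^esub>}}"

definition family_sum :: "('r, 'm) module \<Rightarrow> ('i \<Rightarrow> 'm) \<Rightarrow> 'm" where
  "family_sum M x = (\<Oplus>\<^bsub>M\<^esub>\<alpha>\<in>{\<alpha>. x \<alpha> \<noteq> \<zero>\<^bsub>M\<^esub>}. x \<alpha>)"

definition direct_sum_decomposition ::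
  "('r, 'q) ring_scheme \<Rightarrow> ('r, 'm) module \<Rightarrow> 'i set \<Rightarrow> ('i \<Rightarrow> 'm set) \<Rightarrow> bool"
where
  "direct_sum_decomposition R M J S \<longleftrightarrow>
    (\<forall>\<alpha>\<in>J. submodule (S \<alpha>) R M) \<and> bij_betw (family_sum M) (families M J S) (carrier M)"

definition partial_sum :: "('r, 'm) module \<Rightarrow> 'i set \<Rightarrow> ('i \<Rightarrow> 'm set) \<Rightarrow> ('r, 'm) module" where
  "partial_sum M K S = restrict_to M (family_sum M ` families M K S)"

definition projection ::
  "('r, 'm) module \<Rightarrow> 'i set \<Rightarrow> ('i \<Rightarrow> 'm set) \<Rightarrow> 'i \<Rightarrow> 'm \<Rightarrow> 'm"
where
  "projection M J S \<alpha> x = inv_into (families M J S) (family_sum M) x \<alpha>"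


section \<open>Chain complexes and homotopy equivalence\<close>

definition chain_complex ::
  "side \<Rightarrow> ('r, 'q) ring_scheme \<Rightarrow> (int \<Rightarrow> ('r, 'm) module) \<Rightarrow> (int \<Rightarrow> 'm \<Rightarrow> 'm) \<Rightarrow> bool"
where
  "chain_complex s R C d \<longleftrightarrow>
    (\<forall>n. sided_module s R (C n)) \<and>
    (\<forall>n. d n \<in> lin_maps R (C n) (C (n - 1))) \<and>
    (\<forall>n. \<forall>x\<in>carrier (C n). d (n - 1) (d n x) = \<zero>\<^bsub>C (n - 2)\<^esub>)"

definition chain_map ::
  "('r, 'q) ring_scheme \<Rightarrow> (int \<Rightarrow> ('r, 'm) module) \<Rightarrow> (int \<Rightarrow> 'm \<Rightarrow> 'm) \<Rightarrow>
    (int \<Rightarrow> ('r, 'm) module) \<Rightarrow> (int \<Rightarrow> 'm \<Rightarrow> 'm) \<Rightarrow> (int \<Rightarrow> 'm \<Rightarrow> 'm) \<Rightarrow> bool"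
where
  "chain_map R C d C' d' f \<longleftrightarrow>
    (\<forall>n. f n \<in> lin_maps R (C n) (C' n)) \<and>
    (\<forall>n. \<forall>x\<in>carrier (C n). f (n - 1) (d n x) = d' n (f n x))"

definition chain_homotopic ::
  "('r, 'q) ring_scheme \<Rightarrow> (int \<Rightarrow> ('r, 'm) module) \<Rightarrow> (int \<Rightarrow> 'm \<Rightarrow> 'm) \<Rightarrow>
    (int \<Rightarrow> ('r, 'm) module) \<Rightarrow> (int \<Rightarrow> 'm \<Rightarrow> 'm) \<Rightarrow>
    (int \<Rightarrow> 'm \<Rightarrow> 'm) \<Rightarrow> (int \<Rightarrow> 'm \<Rightarrow> 'm) \<Rightarrow> bool"
where
  "chain_homotopic R C d C' d' f g \<longleftrightarrow>
    (\<exists>h. (\<forall>n. h n \<in> lin_maps R (C n) (C' (n + 1))) \<and>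
         (\<forall>n. \<forall>x\<in>carrier (C n).
            f n x \<ominus>\<^bsub>C' n\<^esub> g n x = d' (n + 1) (h n x) \<oplus>\<^bsub>C' n\<^esub> h (n - 1) (d n x)))"

definition homotopy_equivalent_complexes ::
  "('r, 'q) ring_scheme \<Rightarrow> (int \<Rightarrow> ('r, 'm) module) \<Rightarrow> (int \<Rightarrow> 'm \<Rightarrow> 'm) \<Rightarrow>
    (int \<Rightarrow> ('r, 'm) module) \<Rightarrow> (int \<Rightarrow> 'm \<Rightarrow> 'm) \<Rightarrow> bool"
where
  "homotopy_equivalent_complexes R C d C' d' \<longleftrightarrow>
    (\<exists>f g. chain_map R C d C' d' f \<and> chain_map R C' d' C d g \<and>
       chain_homotopic R C d C d (\<lambda>n. g n \<circ> f n) (\<lambda>n. id) \<and>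
       chain_homotopic R C' d' C' d' (\<lambda>n. f n \<circ> g n) (\<lambda>n. id))"


section \<open>Based complexes and Morse matchings\<close>

definition based_complex ::
  "side \<Rightarrow> ('r, 'q) ring_scheme \<Rightarrow> (int \<Rightarrow> ('r, 'm) module) \<Rightarrow> (int \<Rightarrow> 'm \<Rightarrow> 'm) \<Rightarrow>
    (int \<Rightarrow> 'i set) \<Rightarrow> ('i \<Rightarrow> 'm set) \<Rightarrow> bool"
where
  "based_complex s R C d I S \<longleftrightarrow>
    chain_complex s R C d \<and>
    (\<forall>m n. m \<noteq> n \<longrightarrow> I m \<inter> I n = {}) \<and>
    (\<forall>n. direct_sum_decomposition R (C n) (I n) S)"

definition summand ::
  "(int \<Rightarrow> ('r, 'm) module) \<Rightarrow> ('i \<Rightarrow> 'm set) \<Rightarrow> int \<Rightarrow> 'i \<Rightarrow> ('r, 'm) module"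
where
  "summand C S n \<alpha> = restrict_to (C n) (S \<alpha>)"

text \<open>
  \<open>d_component C d I S n \<beta> \<alpha>\<close> is the component of the differential from the summand of \<open>\<alpha> \<in> I n\<close> to that
  of \<open>\<beta> \<in> I (n - 1)\<close>. All other components of the differential, which has degree \<open>-1\<close>, vanish.
\<close>

definition d_component ::
  "(int \<Rightarrow> ('r, 'm) module) \<Rightarrow> (int \<Rightarrow> 'm \<Rightarrow> 'm) \<Rightarrow> (int \<Rightarrow> 'i set) \<Rightarrow> ('i \<Rightarrow> 'm set) \<Rightarrow>
    int \<Rightarrow> 'i \<Rightarrow> 'i \<Rightarrow> 'm \<Rightarrow> 'm"
where
  "d_component C d I S n \<beta> \<alpha> =
    (\<lambda>x\<in>S \<alpha>. projection (C (n - 1)) (I (n - 1)) S \<beta> (d n x))"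

definition vertices :: "(int \<Rightarrow> 'i set) \<Rightarrow> 'i set" where
  "vertices I = (\<Union>n. I n)"

definition edges ::
  "(int \<Rightarrow> ('r, 'm) module) \<Rightarrow> (int \<Rightarrow> 'm \<Rightarrow> 'm) \<Rightarrow> (int \<Rightarrow> 'i set) \<Rightarrow> ('i \<Rightarrow> 'm set) \<Rightarrow>
    ('i \<times> 'i) set"
where
  "edges C d I S =
    {(\<alpha>, \<beta>). \<exists>n. \<alpha> \<in> I n \<and> \<beta> \<in> I (n - 1) \<and>
        (\<exists>x\<in>S \<alpha>. d_component C d I S n \<beta> \<alpha> x \<noteq> \<zero>\<^bsub>C (n - 1)\<^esub>)}"

definition incident :: "'i \<Rightarrow> 'i \<times> 'i \<Rightarrow> bool" where
  "incident v e \<longleftrightarrow> v = fst e \<or> v = snd e"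

definition reversed_edges :: "('i \<times> 'i) set \<Rightarrow> ('i \<times> 'i) set \<Rightarrow> ('i \<times> 'i) set" where
  "reversed_edges E M = (E - M) \<union> M\<inverse>"

text \<open>
  In the definition below, \<open>(\<gamma>, \<alpha>) \<in> r\<close> means that \<open>\<gamma>\<close> strictly precedes \<open>\<alpha>\<close>; the order may depend
  on the degree. Irreflexivity of \<open>r\<close> follows from \<^term>\<open>wf r\<close>.
\<close>

definition morse_matching ::
  "('r, 'q) ring_scheme \<Rightarrow> (int \<Rightarrow> ('r, 'm) module) \<Rightarrow> (int \<Rightarrow> 'm \<Rightarrow> 'm) \<Rightarrow>
    (int \<Rightarrow> 'i set) \<Rightarrow> ('i \<Rightarrow> 'm set) \<Rightarrow> ('i \<times> 'i) set \<Rightarrow> bool"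
where
  "morse_matching R C d I S M \<longleftrightarrow>
    M \<subseteq> edges C d I S \<and>
    (\<forall>v. \<forall>e\<in>M. \<forall>e'\<in>M. incident v e \<and> incident v e' \<longrightarrow> e = e') \<and>
    (\<forall>n \<alpha> \<beta>. (\<alpha>, \<beta>) \<in> M \<and> \<alpha> \<in> I n \<longrightarrow>
        d_component C d I S n \<beta> \<alpha> \<in> lin_isos R (summand C S n \<alpha>) (summand C S (n - 1) \<beta>)) \<and>
    (\<forall>n. \<exists>r \<subseteq> I n \<times> I n. trans r \<and> wf r \<and>
        (\<forall>\<alpha>\<in>I n. \<forall>\<gamma>\<in>I n. \<forall>\<beta>.
            (\<alpha>, \<beta>) \<in> reversed_edges (edges C d I S) M \<and>
            (\<beta>, \<gamma>) \<in> reversed_edges (edges C d I S) M \<longrightarrow> (\<gamma>, \<alpha>) \<in> r))"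

definition unmatched :: "(int \<Rightarrow> 'i set) \<Rightarrow> ('i \<times> 'i) set \<Rightarrow> 'i set" where
  "unmatched I M = {v \<in> vertices I. \<forall>e\<in>M. \<not> incident v e}"

end

theory Submission
  imports Defs
begin

text \<open>
  The proof eliminates all matched summands at once, as in Gaussian elimination. Call a matched vertex a
  tail or a head according to whether its edge in \<open>M\<close> leaves or enters it, and call unmatched vertices
  critical. Write \<open>T\<close> for the block of the differential that goes from the sum of all tail summands
  of degree \<open>n + 1\<close> to the sum of all head summands of degree \<open>n\<close>. Condition (i) makes the matched
  components of \<open>T\<close> isomorphisms, and condition (ii) makes \<open>T\<close> triangular with respect to a
  well-founded order on the tails. As elements of a direct sum have finite support, \<open>T\<close> is injective
  (look at a maximal index in the support), and by well-founded induction it is surjective; see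
  \<open>tails_to_heads_injective\<close> and \<open>tails_to_heads_surjective\<close>.

  Let \<open>h\<close> be the inverse of \<open>T\<close> preceded by the projection onto the heads. Then \<open>h h = 0\<close> and
  \<open>h d h = h\<close>, so \<open>\<pi> = 1 - d h - h d\<close> is an idempotent chain map that is homotopic to the
  identity, and \<open>C\<close> is homotopy equivalent to the image of \<open>\<pi>\<close>. The projection \<open>e\<close> onto the critical
  summands maps this image isomorphically onto their sum, with inverse the restriction of \<open>\<pi>\<close>:
  on critical summands \<open>e \<pi> = 1\<close>, and \<open>\<pi> e \<pi> = \<pi>\<close> because \<open>h \<pi> = 0\<close> leaves the image of \<open>\<pi>\<close> without
  components at heads, while \<open>\<pi>\<close> kills the tails. Transport of structure gives the differential \<open>e \<pi> d\<close>
  on the sum of the critical summands. This part is carried out in the locale \<open>contraction\<close>.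
\<close>


section \<open>Modules and linear maps\<close>

context sided_module
begin

lemma smult_zero_right:
  assumes "a \<in> carrier R"
  shows "a \<odot>\<^bsub>M\<^esub> \<zero>\<^bsub>M\<^esub> = \<zero>\<^bsub>M\<^esub>"
proof -
  have "a \<odot>\<^bsub>M\<^esub> \<zero>\<^bsub>M\<^esub> \<oplus>\<^bsub>M\<^esub> a \<odot>\<^bsub>M\<^esub> \<zero>\<^bsub>M\<^esub> = a \<odot>\<^bsub>M\<^esub> \<zero>\<^bsub>M\<^esub>"
    using smult_r_distr[OF assms M.zero_closed M.zero_closed] by simp
  then show ?thesis
    using smult_closed[OF assms M.zero_closed] by (metis M.add.r_cancel_one')
qed

lemma smult_minus:
  assumes "a \<in> carrier R" "x \<in> carrier M"
  shows "a \<odot>\<^bsub>M\<^esub> (\<ominus>\<^bsub>M\<^esub> x) = \<ominus>\<^bsub>M\<^esub> (a \<odot>\<^bsub>M\<^esub> x)"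
proof -
  have "a \<odot>\<^bsub>M\<^esub> (\<ominus>\<^bsub>M\<^esub> x) \<oplus>\<^bsub>M\<^esub> a \<odot>\<^bsub>M\<^esub> x = \<zero>\<^bsub>M\<^esub>"
    using smult_r_distr[of a "\<ominus>\<^bsub>M\<^esub> x" x] assms smult_zero_right by (simp add: M.l_neg)
  then show ?thesis
    using assms smult_closed M.minus_equality by simp
qed

lemma smult_finsum:
  assumes "a \<in> carrier R" and "finite F" and "\<And>i. i \<in> F \<Longrightarrow> x i \<in> carrier M"
  shows "a \<odot>\<^bsub>M\<^esub> (\<Oplus>\<^bsub>M\<^esub>i\<in>F. x i) = (\<Oplus>\<^bsub>M\<^esub>i\<in>F. a \<odot>\<^bsub>M\<^esub> x i)"
  using assms(2,3)
proof (induction F rule: finite_induct)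
  case empty
  then show ?case by (simp add: smult_zero_right assms)
next
  case (insert i F)
  then show ?case
    by (simp add: Pi_def smult_r_distr smult_closed assms(1))
qed

lemma submoduleI:
  assumes "H \<subseteq> carrier M" and "\<zero>\<^bsub>M\<^esub> \<in> H"
    and "\<And>x. x \<in> H \<Longrightarrow> \<ominus>\<^bsub>M\<^esub> x \<in> H"
    and "\<And>x y. x \<in> H \<Longrightarrow> y \<in> H \<Longrightarrow> x \<oplus>\<^bsub>M\<^esub> y \<in> H"
    and "\<And>a x. a \<in> carrier R \<Longrightarrow> x \<in> H \<Longrightarrow> a \<odot>\<^bsub>M\<^esub> x \<in> H"
  shows "submodule H R M"
  by (intro submodule.intro subgroup.intro) (use assms in \<open>auto simp: submodule_axioms_def a_inv_def\<close>)

lemma submodule_facts: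
  assumes "submodule H R M"
  shows "x \<in> H \<Longrightarrow> x \<in> carrier M" and "\<zero>\<^bsub>M\<^esub> \<in> H"
    and "x \<in> H \<Longrightarrow> y \<in> H \<Longrightarrow> x \<oplus>\<^bsub>M\<^esub> y \<in> H"
    and "a \<in> carrier R \<Longrightarrow> x \<in> H \<Longrightarrow> a \<odot>\<^bsub>M\<^esub> x \<in> H"
    and "x \<in> H \<Longrightarrow> \<ominus>\<^bsub>M\<^esub> x \<in> H"
proof -
  interpret H: submodule H R M by fact
  show "x \<in> H \<Longrightarrow> x \<in> carrier M" "\<zero>\<^bsub>M\<^esub> \<in> H" "x \<in> H \<Longrightarrow> y \<in> H \<Longrightarrow> x \<oplus>\<^bsub>M\<^esub> y \<in> H"
    "a \<in> carrier R \<Longrightarrow> x \<in> H \<Longrightarrow> a \<odot>\<^bsub>M\<^esub> x \<in> H" "x \<in> H \<Longrightarrow> \<ominus>\<^bsub>M\<^esub> x \<in> H"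
    using H.subset H.one_closed H.m_closed H.smult_closed H.m_inv_closed by (auto simp: a_inv_def)
qed

lemma sided_module_restrict:
  assumes H: "submodule H R M"
  shows "sided_module s R (M\<lparr>carrier := H\<rparr>)"
proof -
  note H' = submodule_facts[OF H]
  interpret N: abelian_group "M\<lparr>carrier := H\<rparr>"
  proof (rule abelian_groupI)
    fix x assume x: "x \<in> carrier (M\<lparr>carrier := H\<rparr>)"
    show "\<exists>y\<in>carrier (M\<lparr>carrier := H\<rparr>). y \<oplus>\<^bsub>M\<lparr>carrier := H\<rparr>\<^esub> x = \<zero>\<^bsub>M\<lparr>carrier := H\<rparr>\<^esub>"
      using x H'(1)[of x] H'(5)[of x] M.l_neg by auto
  qed (use H' in \<open>auto simp: M.a_ac\<close>)
  show ?thesis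
    by unfold_locales
      (use H' smult_l_distr smult_r_distr smult_assoc smult_one in \<open>auto\<close>)
qed

end

lemma lin_mapsD:
  assumes "f \<in> lin_maps R M N"
  shows "x \<in> carrier M \<Longrightarrow> f x \<in> carrier N"
    and "x \<in> carrier M \<Longrightarrow> y \<in> carrier M \<Longrightarrow> f (x \<oplus>\<^bsub>M\<^esub> y) = f x \<oplus>\<^bsub>N\<^esub> f y"
    and "a \<in> carrier R \<Longrightarrow> x \<in> carrier M \<Longrightarrow> f (a \<odot>\<^bsub>M\<^esub> x) = a \<odot>\<^bsub>N\<^esub> f x"
  using assms by (auto simp: lin_maps_def)

lemma lin_mapsI:
  assumes "\<And>x. x \<in> carrier M \<Longrightarrow> f x \<in> carrier N"
    and "\<And>x y. x \<in> carrier M \<Longrightarrow> y \<in> carrier M \<Longrightarrow> f (x \<oplus>\<^bsub>M\<^esub> y) = f x \<oplus>\<^bsub>N\<^esub> f y"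
    and "\<And>a x. a \<in> carrier R \<Longrightarrow> x \<in> carrier M \<Longrightarrow> f (a \<odot>\<^bsub>M\<^esub> x) = a \<odot>\<^bsub>N\<^esub> f x"
  shows "f \<in> lin_maps R M N"
  using assms by (auto simp: lin_maps_def)

context
  fixes s R M N f
  assumes M: "sided_module s R M" and N: "sided_module s R N"
    and f: "f \<in> lin_maps R M N"
begin

interpretation M: sided_module s R M by (fact M)
interpretation N: sided_module s R N by (fact N)

lemma lin_maps_zero: "f \<zero>\<^bsub>M\<^esub> = \<zero>\<^bsub>N\<^esub>"
proof -
  have "f \<zero>\<^bsub>M\<^esub> \<oplus>\<^bsub>N\<^esub> f \<zero>\<^bsub>M\<^esub> = f \<zero>\<^bsub>M\<^esub>"
    using lin_mapsD(2)[OF f, of "\<zero>\<^bsub>M\<^esub>" "\<zero>\<^bsub>M\<^esub>"] by simp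
  then show ?thesis
    using lin_mapsD(1)[OF f, of "\<zero>\<^bsub>M\<^esub>"] by (metis N.M.add.r_cancel_one' M.M.zero_closed)
qed

lemma lin_maps_a_inv:
  assumes "x \<in> carrier M"
  shows "f (\<ominus>\<^bsub>M\<^esub> x) = \<ominus>\<^bsub>N\<^esub> f x"
proof -
  have "f (\<ominus>\<^bsub>M\<^esub> x) \<oplus>\<^bsub>N\<^esub> f x = \<zero>\<^bsub>N\<^esub>"
    using lin_mapsD(2)[OF f, of "\<ominus>\<^bsub>M\<^esub> x" x] assms lin_maps_zero by (simp add: M.M.l_neg)
  then show ?thesis
    using assms lin_mapsD(1)[OF f] N.M.minus_equality by simp
qed

lemma lin_maps_minus:
  assumes "x \<in> carrier M" "y \<in> carrier M"
  shows "f (x \<ominus>\<^bsub>M\<^esub> y) = f x \<ominus>\<^bsub>N\<^esub> f y"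
  using assms by (simp add: a_minus_def lin_mapsD(2)[OF f] lin_maps_a_inv)

end

lemma lin_maps_comp:
  "f \<in> lin_maps R M N \<Longrightarrow> g \<in> lin_maps R N P \<Longrightarrow> (\<lambda>x. g (f x)) \<in> lin_maps R M P"
  by (rule lin_mapsI) (auto simp: lin_mapsD)

lemma lin_maps_id: "(\<lambda>x. x) \<in> lin_maps R M M"
  by (rule lin_mapsI) auto

context
  fixes s R and M :: "('r, 'm) module"
  assumes M: "sided_module s R M"
begin

interpretation sided_module s R M by (fact M)

lemma lin_maps_const_zero:
  "(\<lambda>x. \<zero>\<^bsub>M\<^esub>) \<in> lin_maps R N M"
  by (rule lin_mapsI) (auto simp: smult_zero_right)

lemma lin_maps_add:
  assumes "f \<in> lin_maps R N M" "g \<in> lin_maps R N M"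
  shows "(\<lambda>x. f x \<oplus>\<^bsub>M\<^esub> g x) \<in> lin_maps R N M"
  by (rule lin_mapsI)
    (auto simp: lin_mapsD[OF assms(1)] lin_mapsD[OF assms(2)] M.a_ac smult_r_distr)

lemma lin_maps_uminus:
  assumes "f \<in> lin_maps R N M"
  shows "(\<lambda>x. \<ominus>\<^bsub>M\<^esub> f x) \<in> lin_maps R N M"
  by (rule lin_mapsI) (auto simp: lin_mapsD[OF assms] M.minus_add smult_minus)

lemma lin_maps_diff:
  assumes "f \<in> lin_maps R N M" "g \<in> lin_maps R N M"
  shows "(\<lambda>x. f x \<ominus>\<^bsub>M\<^esub> g x) \<in> lin_maps R N M"
  using lin_maps_add[OF assms(1) lin_maps_uminus[OF assms(2)]] by (simp add: a_minus_def)

end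


section \<open>Direct sum decompositions\<close>

text \<open>A module with a direct sum decomposition; \<open>component \<alpha> x\<close> below is the component of \<open>x\<close> in \<open>S \<alpha>\<close>,
  which is zero for \<open>\<alpha> \<notin> J\<close>.\<close>

locale decomposed_module = sided_module s R M
  for s and R :: "('r, 'q) ring_scheme" (structure) and M :: "('r, 'm) module" (structure) +
  fixes J :: "'i set" and S :: "'i \<Rightarrow> 'm set"
  assumes decomposition: "direct_sum_decomposition R M J S"
begin

abbreviation component :: "'i \<Rightarrow> 'm \<Rightarrow> 'm" where
  "component \<equiv> projection M J S"

lemma submodule_S: "\<alpha> \<in> J \<Longrightarrow> submodule (S \<alpha>) R M"
  using decomposition by (auto simp: direct_sum_decomposition_def)

lemma S_facts:
  assumes "\<alpha> \<in> J"
  shows "x \<in> S \<alpha> \<Longrightarrow> x \<in> carrier M" and "\<zero>\<^bsub>M\<^esub> \<in> S \<alpha>"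
    and "x \<in> S \<alpha> \<Longrightarrow> y \<in> S \<alpha> \<Longrightarrow> x \<oplus>\<^bsub>M\<^esub> y \<in> S \<alpha>"
    and "a \<in> carrier R \<Longrightarrow> x \<in> S \<alpha> \<Longrightarrow> a \<odot>\<^bsub>M\<^esub> x \<in> S \<alpha>"
  using submodule_facts[OF submodule_S[OF assms]] by blast+

lemma families_carrier: "x \<in> families M J S \<Longrightarrow> x \<alpha> \<in> carrier M"
  by (cases "\<alpha> \<in> J") (auto simp: families_def S_facts(1))

lemma family_sum_superset:
  assumes "x \<in> families M J S" and "finite F" and "{\<alpha>. x \<alpha> \<noteq> \<zero>\<^bsub>M\<^esub>} \<subseteq> F"
  shows "family_sum M x = (\<Oplus>\<^bsub>M\<^esub>\<alpha>\<in>F. x \<alpha>)"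
  unfolding family_sum_def
  by (rule M.add.finprod_mono_neutral_cong_left) (use assms families_carrier in auto)

lemma families_add:
  assumes "x \<in> families M J S" "y \<in> families M J S"
  shows "(\<lambda>\<alpha>. x \<alpha> \<oplus>\<^bsub>M\<^esub> y \<alpha>) \<in> families M J S"
    and "family_sum M (\<lambda>\<alpha>. x \<alpha> \<oplus>\<^bsub>M\<^esub> y \<alpha>) = family_sum M x \<oplus>\<^bsub>M\<^esub> family_sum M y"
proof -
  let ?F = "{\<alpha>. x \<alpha> \<noteq> \<zero>\<^bsub>M\<^esub>} \<union> {\<alpha>. y \<alpha> \<noteq> \<zero>\<^bsub>M\<^esub>}"
  have F: "finite ?F" "{\<alpha>. x \<alpha> \<oplus>\<^bsub>M\<^esub> y \<alpha> \<noteq> \<zero>\<^bsub>M\<^esub>} \<subseteq> ?F"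
    using assms by (auto simp: families_def)
  show z: "(\<lambda>\<alpha>. x \<alpha> \<oplus>\<^bsub>M\<^esub> y \<alpha>) \<in> families M J S"
    using finite_subset[OF F(2,1)] assms by (auto simp: families_def S_facts(3))
  show "family_sum M (\<lambda>\<alpha>. x \<alpha> \<oplus>\<^bsub>M\<^esub> y \<alpha>) = family_sum M x \<oplus>\<^bsub>M\<^esub> family_sum M y"
    using F(1) assms families_carrier
    by (subst family_sum_superset[OF z F], subst (1 2) family_sum_superset[where F = ?F])
      (auto intro!: M.finsum_addf)
qed

lemma families_smult:
  assumes "a \<in> carrier R" "x \<in> families M J S"
  shows "(\<lambda>\<alpha>. a \<odot>\<^bsub>M\<^esub> x \<alpha>) \<in> families M J S"
    and "family_sum M (\<lambda>\<alpha>. a \<odot>\<^bsub>M\<^esub> x \<alpha>) = a \<odot>\<^bsub>M\<^esub> family_sum M x"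
proof -
  let ?F = "{\<alpha>. x \<alpha> \<noteq> \<zero>\<^bsub>M\<^esub>}"
  have F: "finite ?F" "{\<alpha>. a \<odot>\<^bsub>M\<^esub> x \<alpha> \<noteq> \<zero>\<^bsub>M\<^esub>} \<subseteq> ?F"
    using assms by (auto simp: families_def smult_zero_right)
  show z: "(\<lambda>\<alpha>. a \<odot>\<^bsub>M\<^esub> x \<alpha>) \<in> families M J S"
    using finite_subset[OF F(2,1)] assms by (auto simp: families_def S_facts(4) smult_zero_right)
  show "family_sum M (\<lambda>\<alpha>. a \<odot>\<^bsub>M\<^esub> x \<alpha>) = a \<odot>\<^bsub>M\<^esub> family_sum M x"
    unfolding family_sum_superset[OF z F] family_sum_superset[OF assms(2) F(1) order_refl]
    by (rule smult_finsum[symmetric]) (use F assms families_carrier in auto)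
qed

lemma component_family:
  assumes "x \<in> carrier M"
  shows "(\<lambda>\<alpha>. component \<alpha> x) \<in> families M J S" and "family_sum M (\<lambda>\<alpha>. component \<alpha> x) = x"
proof -
  have "bij_betw (family_sum M) (families M J S) (carrier M)"
    using decomposition by (auto simp: direct_sum_decomposition_def)
  then have x: "x \<in> family_sum M ` families M J S"
    using assms by (simp add: bij_betw_def)
  show "(\<lambda>\<alpha>. component \<alpha> x) \<in> families M J S" "family_sum M (\<lambda>\<alpha>. component \<alpha> x) = x"
    unfolding projection_def using inv_into_into[OF x] f_inv_into_f[OF x] by simp_all
qed

lemma family_sum_carrier: "x \<in> families M J S \<Longrightarrow> family_sum M x \<in> carrier M"
  using decomposition by (auto simp: direct_sum_decomposition_def bij_betw_def)

lemma component_family_sum: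
  assumes "x \<in> families M J S"
  shows "component \<alpha> (family_sum M x) = x \<alpha>"
  using assms decomposition
  by (simp add: projection_def direct_sum_decomposition_def bij_betw_def inv_into_f_f)

lemma component_in_S: "x \<in> carrier M \<Longrightarrow> \<alpha> \<in> J \<Longrightarrow> component \<alpha> x \<in> S \<alpha>"
  and component_outside: "x \<in> carrier M \<Longrightarrow> \<alpha> \<notin> J \<Longrightarrow> component \<alpha> x = \<zero>\<^bsub>M\<^esub>"
  and component_finite: "x \<in> carrier M \<Longrightarrow> finite {\<alpha>. component \<alpha> x \<noteq> \<zero>\<^bsub>M\<^esub>}"
  and component_carrier: "x \<in> carrier M \<Longrightarrow> component \<alpha> x \<in> carrier M"
  using component_family(1)[of x] families_carrier[of "\<lambda>\<alpha>. component \<alpha> x" \<alpha>]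
  by (simp_all add: families_def)

lemma component_eqI:
  assumes "x \<in> carrier M" "y \<in> carrier M" "\<And>\<alpha>. component \<alpha> x = component \<alpha> y"
  shows "x = y"
proof -
  have "x = family_sum M (\<lambda>\<alpha>. component \<alpha> x)"
    by (simp only: component_family(2)[OF assms(1)])
  also have "\<dots> = family_sum M (\<lambda>\<alpha>. component \<alpha> y)"
    by (simp only: assms(3))
  also have "\<dots> = y"
    by (rule component_family(2)[OF assms(2)])
  finally show ?thesis .
qed

lemma component_lin_maps: "component \<alpha> \<in> lin_maps R M M"
proof (rule lin_mapsI)
  show "component \<alpha> (x \<oplus>\<^bsub>M\<^esub> y) = component \<alpha> x \<oplus>\<^bsub>M\<^esub> component \<alpha> y"
    if "x \<in> carrier M" "y \<in> carrier M" for x y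
    using component_family_sum[OF families_add(1)[OF that[THEN component_family(1)]]]
      families_add(2)[OF that[THEN component_family(1)]] that[THEN component_family(2)] by simp
  show "component \<alpha> (a \<odot>\<^bsub>M\<^esub> x) = a \<odot>\<^bsub>M\<^esub> component \<alpha> x"
    if "a \<in> carrier R" "x \<in> carrier M" for a x
    using component_family_sum[OF families_smult(1)[OF that(1) component_family(1)[OF that(2)]]]
      families_smult(2)[OF that(1) component_family(1)[OF that(2)]] component_family(2)[OF that(2)] by simp
qed (rule component_carrier)

lemma component_single:
  assumes "\<alpha> \<in> J" "x \<in> S \<alpha>"
  shows "component \<beta> x = (if \<beta> = \<alpha> then x else \<zero>\<^bsub>M\<^esub>)"
proof -
  let ?f = "\<lambda>\<beta>. if \<beta> = \<alpha> then x else \<zero>\<^bsub>M\<^esub>"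
  have fam: "?f \<in> families M J S"
    using assms by (auto simp: families_def S_facts(2))
  have "family_sum M ?f = finsum M ?f {\<alpha>}"
    by (rule family_sum_superset[OF fam]) auto
  also have "\<dots> = x"
    using S_facts(1)[OF assms] by (simp add: Pi_def)
  finally show ?thesis
    using component_family_sum[OF fam, of \<beta>] by simp
qed

text \<open>An additive property that holds for every component of an element holds for the element. This
  is how statements about the summands are extended to the whole module.\<close>

lemma component_induct:
  assumes "x \<in> carrier M" and "\<And>\<alpha>. \<alpha> \<in> J \<Longrightarrow> P (component \<alpha> x)" and "P \<zero>\<^bsub>M\<^esub>"
    and add: "\<And>x y. x \<in> carrier M \<Longrightarrow> y \<in> carrier M \<Longrightarrow> P x \<Longrightarrow> P y \<Longrightarrow> P (x \<oplus>\<^bsub>M\<^esub> y)"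
  shows "P x"
proof -
  have P: "P (component \<alpha> x)" for \<alpha>
    using assms(1-3) component_outside by (cases "\<alpha> \<in> J") auto
  have "P (\<Oplus>\<^bsub>M\<^esub>\<alpha>\<in>F. component \<alpha> x)" if "finite F" for F
    using that
  proof (induction F rule: finite_induct)
    case (insert \<alpha> F)
    then show ?case
      using component_carrier[OF assms(1)] P by (simp add: Pi_def add)
  qed (simp add: assms(3))
  then have "P (family_sum M (\<lambda>\<alpha>. component \<alpha> x))"
    unfolding family_sum_def using component_finite[OF assms(1)] .
  then show ?thesis
    by (simp add: component_family(2)[OF assms(1)])
qed

text \<open>The projection onto the sum of the submodules indexed by \<open>K \<inter> J\<close>; the set \<open>K\<close> need not be
  contained in \<open>J\<close>, so complements may be used.\<close>

definition part :: "'i set \<Rightarrow> 'm \<Rightarrow> 'm" where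
  "part K x = family_sum M (\<lambda>\<alpha>. if \<alpha> \<in> K then component \<alpha> x else \<zero>\<^bsub>M\<^esub>)"

lemma
  assumes "x \<in> carrier M"
  shows part_carrier: "part K x \<in> carrier M"
    and component_part: "component \<alpha> (part K x) = (if \<alpha> \<in> K then component \<alpha> x else \<zero>\<^bsub>M\<^esub>)"
proof -
  have "finite {\<alpha>. (if \<alpha> \<in> K then component \<alpha> x else \<zero>\<^bsub>M\<^esub>) \<noteq> \<zero>\<^bsub>M\<^esub>}"
    by (rule finite_subset[OF _ component_finite[OF assms]]) auto
  then have "(\<lambda>\<alpha>. if \<alpha> \<in> K then component \<alpha> x else \<zero>\<^bsub>M\<^esub>) \<in> families M J S"
    using component_in_S component_outside assms S_facts(2) by (auto simp: families_def)
  then show "part K x \<in> carrier M" "component \<alpha> (part K x) = (if \<alpha> \<in> K then component \<alpha> x else \<zero>\<^bsub>M\<^esub>)"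
    unfolding part_def by (auto simp: family_sum_carrier component_family_sum)
qed

lemma part_lin_maps: "part K \<in> lin_maps R M M"
proof (rule lin_mapsI)
  show "part K (x \<oplus>\<^bsub>M\<^esub> y) = part K x \<oplus>\<^bsub>M\<^esub> part K y"
    if "x \<in> carrier M" "y \<in> carrier M" for x y
    by (rule component_eqI)
      (use that in \<open>auto simp: part_carrier component_part lin_mapsD(2)[OF component_lin_maps]\<close>)
  show "part K (a \<odot>\<^bsub>M\<^esub> x) = a \<odot>\<^bsub>M\<^esub> part K x"
    if "a \<in> carrier R" "x \<in> carrier M" for a x
    by (rule component_eqI)
      (use that in \<open>auto simp: part_carrier component_part smult_closed smult_zero_right
        lin_mapsD(3)[OF component_lin_maps]\<close>)
qed (rule part_carrier)

lemma partial_sum_carrier: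
  assumes "K \<subseteq> J"
  shows "carrier (partial_sum M K S) = {x \<in> carrier M. \<forall>\<alpha>. \<alpha> \<notin> K \<longrightarrow> component \<alpha> x = \<zero>\<^bsub>M\<^esub>}"
proof (intro equalityI subsetI)
  fix x assume "x \<in> carrier (partial_sum M K S)"
  then obtain f where f: "f \<in> families M K S" "x = family_sum M f"
    by (auto simp: partial_sum_def)
  then have "f \<in> families M J S"
    using assms S_facts(2) by (fastforce simp: families_def)
  then show "x \<in> {x \<in> carrier M. \<forall>\<alpha>. \<alpha> \<notin> K \<longrightarrow> component \<alpha> x = \<zero>\<^bsub>M\<^esub>}"
    using f by (auto simp: component_family_sum family_sum_carrier families_def)
next
  fix x assume x: "x \<in> {x \<in> carrier M. \<forall>\<alpha>. \<alpha> \<notin> K \<longrightarrow> component \<alpha> x = \<zero>\<^bsub>M\<^esub>}"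
  then have "(\<lambda>\<alpha>. component \<alpha> x) \<in> families M K S"
    using component_family(1)[of x] assms by (auto simp: families_def)
  then show "x \<in> carrier (partial_sum M K S)"
    using component_family(2)[of x] x by (force simp: partial_sum_def)
qed

lemma partial_sum_submodule:
  assumes "K \<subseteq> J"
  shows "submodule (carrier (partial_sum M K S)) R M"
  unfolding partial_sum_carrier[OF assms]
  by (rule submoduleI)
    (auto simp: smult_closed smult_zero_right lin_mapsD[OF component_lin_maps]
      lin_maps_zero[OF sided_module_axioms sided_module_axioms component_lin_maps]
      lin_maps_a_inv[OF sided_module_axioms sided_module_axioms component_lin_maps])

lemma part_in_partial_sum:
  "K \<subseteq> J \<Longrightarrow> x \<in> carrier M \<Longrightarrow> part K x \<in> carrier (partial_sum M K S)"
  by (simp add: partial_sum_carrier part_carrier component_part)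

lemma part_id:
  assumes "K \<subseteq> J" "x \<in> carrier (partial_sum M K S)"
  shows "part K x = x"
  by (rule component_eqI) (use assms in \<open>auto simp: partial_sum_carrier part_carrier component_part\<close>)

lemma split_component:
  assumes "\<alpha> \<in> J" "x \<in> carrier M"
  shows "x = component \<alpha> x \<oplus>\<^bsub>M\<^esub> part (- {\<alpha>}) x"
  by (rule component_eqI)
    (use assms in \<open>auto simp: part_carrier component_part component_carrier lin_mapsD(2)[OF component_lin_maps]
      component_single[OF assms(1) component_in_S]\<close>)

lemma S_in_partial_sum:
  assumes "K \<subseteq> J" "\<alpha> \<in> K" "x \<in> S \<alpha>"
  shows "x \<in> carrier (partial_sum M K S)"
  using assms component_single[of \<alpha> x] S_facts(1)[of \<alpha> x] by (auto simp: partial_sum_carrier)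

lemma part_eq_zero_iff:
  assumes "x \<in> carrier M"
  shows "part K x = \<zero>\<^bsub>M\<^esub> \<longleftrightarrow> (\<forall>\<alpha>\<in>K. component \<alpha> x = \<zero>\<^bsub>M\<^esub>)"
proof
  have zero: "component \<alpha> \<zero>\<^bsub>M\<^esub> = \<zero>\<^bsub>M\<^esub>" for \<alpha>
    by (rule lin_maps_zero[OF sided_module_axioms sided_module_axioms component_lin_maps])
  show "\<forall>\<alpha>\<in>K. component \<alpha> x = \<zero>\<^bsub>M\<^esub>" if "part K x = \<zero>\<^bsub>M\<^esub>"
    using that component_part[OF assms, of _ K] zero by metis
  show "part K x = \<zero>\<^bsub>M\<^esub>" if "\<forall>\<alpha>\<in>K. component \<alpha> x = \<zero>\<^bsub>M\<^esub>"
    by (rule component_eqI) (use that assms in \<open>auto simp: part_carrier component_part zero\<close>)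
qed

end


section \<open>Contractions of chain complexes\<close>

text \<open>
  The data of a contraction of a complex onto graded submodules \<open>A n\<close>: a degree \<open>1\<close> map \<open>h\<close> and
  projections \<open>e n\<close> onto \<open>A n\<close>. The last assumption says that \<open>h d\<close> is the identity on the part of the
  kernel of \<open>h\<close> that is complementary to \<open>A\<close>. The differential does not preserve \<open>A\<close> in general.
\<close>

locale contraction =
  fixes s :: side
    and R :: "('r, 'q) ring_scheme"
    and C :: "int \<Rightarrow> ('r, 'm) module"
    and d h e :: "int \<Rightarrow> 'm \<Rightarrow> 'm"
    and A :: "int \<Rightarrow> 'm set"
  assumes complex: "chain_complex s R C d"
    and submodule_A: "submodule (A n) R (C n)"
    and h_lin: "h n \<in> lin_maps R (C n) (C (n + 1))"
    and e_lin: "e n \<in> lin_maps R (C n) (C n)"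
    and e_in_A: "x \<in> carrier (C n) \<Longrightarrow> e n x \<in> A n"
    and e_on_A: "x \<in> A n \<Longrightarrow> e n x = x"
    and h_h: "x \<in> carrier (C n) \<Longrightarrow> h (n + 1) (h n x) = \<zero>\<^bsub>C (n + 2)\<^esub>"
    and h_d_h: "x \<in> carrier (C n) \<Longrightarrow> h n (d (n + 1) (h n x)) = h n x"
    and h_on_A: "x \<in> A n \<Longrightarrow> h n x = \<zero>\<^bsub>C (n + 1)\<^esub>"
    and e_h: "x \<in> carrier (C n) \<Longrightarrow> e (n + 1) (h n x) = \<zero>\<^bsub>C (n + 1)\<^esub>"
    and h_d_complement: "x \<in> carrier (C n) \<Longrightarrow> h n x = \<zero>\<^bsub>C (n + 1)\<^esub> \<Longrightarrow>
        h (n - 1) (d n (x \<ominus>\<^bsub>C n\<^esub> e n x)) = x \<ominus>\<^bsub>C n\<^esub> e n x"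
begin

lemma C_module: "sided_module s R (C n)"
  using complex by (simp add: chain_complex_def)

sublocale C: sided_module s R "C n" for n
  by (rule C_module)

lemma d_lin: "d n \<in> lin_maps R (C n) (C (n - 1))"
  and d_d: "x \<in> carrier (C n) \<Longrightarrow> d (n - 1) (d n x) = \<zero>\<^bsub>C (n - 2)\<^esub>"
  using complex by (auto simp: chain_complex_def)

lemma dh_lin: "(\<lambda>x. d (n + 1) (h n x)) \<in> lin_maps R (C n) (C n)"
  using lin_maps_comp[OF h_lin[of n] d_lin[of "n + 1"]] by simp

lemma hd_lin: "(\<lambda>x. h (n - 1) (d n x)) \<in> lin_maps R (C n) (C n)"
  using lin_maps_comp[OF d_lin[of n] h_lin[of "n - 1"]] by simp

lemmas closed [simp] =
  lin_mapsD(1)[OF d_lin] lin_mapsD(1)[OF h_lin] lin_mapsD(1)[OF e_lin]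
  lin_mapsD(1)[OF dh_lin] lin_mapsD(1)[OF hd_lin]

lemmas zeros [simp] =
  lin_maps_zero[OF C_module C_module d_lin] lin_maps_zero[OF C_module C_module h_lin]
  lin_maps_zero[OF C_module C_module e_lin]

lemma minus_zero [simp]: "x \<in> carrier (C n) \<Longrightarrow> x \<ominus>\<^bsub>C n\<^esub> \<zero>\<^bsub>C n\<^esub> = x"
  by (simp add: a_minus_def)

lemma minus_eq_zero:
  assumes "x \<in> carrier (C n)" "y \<in> carrier (C n)" "x \<ominus>\<^bsub>C n\<^esub> y = \<zero>\<^bsub>C n\<^esub>"
  shows "x = y"
  using assms C.M.minus_equality[of n x "\<ominus>\<^bsub>C n\<^esub> y"] by (simp add: a_minus_def)

lemma add_minus_cancel:
  assumes "x \<in> carrier (C n)" "y \<in> carrier (C n)"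
  shows "x \<oplus>\<^bsub>C n\<^esub> y \<ominus>\<^bsub>C n\<^esub> x = y"
  using assms C.M.a_comm[of x _ y] by (simp add: a_minus_def C.M.a_assoc C.M.r_neg)

lemma minus_self [simp]: "x \<in> carrier (C n) \<Longrightarrow> x \<ominus>\<^bsub>C n\<^esub> x = \<zero>\<^bsub>C n\<^esub>"
  by (simp add: a_minus_def C.M.r_neg)

text \<open>The map \<open>1 - d h - h d\<close>. It is an idempotent chain map, homotopic to the identity by
  construction.\<close>

definition pr :: "int \<Rightarrow> 'm \<Rightarrow> 'm" where
  "pr n x = (x \<ominus>\<^bsub>C n\<^esub> d (n + 1) (h n x)) \<ominus>\<^bsub>C n\<^esub> h (n - 1) (d n x)"

lemma pr_lin: "pr n \<in> lin_maps R (C n) (C n)"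
  unfolding pr_def by (intro lin_maps_diff[OF C_module] lin_maps_id dh_lin hd_lin)

lemmas pr_closed [simp] = lin_mapsD(1)[OF pr_lin]
lemmas pr_zero [simp] = lin_maps_zero[OF C_module C_module pr_lin]

lemma d_pr:
  assumes "x \<in> carrier (C n)"
  shows "pr (n - 1) (d n x) = d n (pr n x)"
proof -
  have "d n (d (n + 1) (h n x)) = \<zero>\<^bsub>C (n - 1)\<^esub>"
    using d_d[of "h n x" "n + 1"] assms by simp
  then have "d n (pr n x) = d n x \<ominus>\<^bsub>C (n - 1)\<^esub> d n (h (n - 1) (d n x))"
    using assms by (simp add: pr_def lin_maps_minus[OF C_module C_module d_lin])
  moreover have "h (n - 2) (d (n - 1) (d n x)) = \<zero>\<^bsub>C (n - 1)\<^esub>"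
    using assms lin_maps_zero[OF C_module C_module h_lin[of "n - 2"]] by (simp add: d_d)
  then have "pr (n - 1) (d n x) = d n x \<ominus>\<^bsub>C (n - 1)\<^esub> d n (h (n - 1) (d n x))"
    using assms lin_mapsD(1)[OF dh_lin[of "n - 1"], of "d n x"] by (simp add: pr_def)
  ultimately show ?thesis
    by simp
qed

lemma h_pr:
  assumes "x \<in> carrier (C n)"
  shows "h n (pr n x) = \<zero>\<^bsub>C (n + 1)\<^esub>"
proof -
  have "h n (h (n - 1) (d n x)) = \<zero>\<^bsub>C (n + 1)\<^esub>"
    using h_h[of "d n x" "n - 1"] assms by (simp add: add.commute[of 1 n])
  then show ?thesis
    using assms by (simp add: pr_def lin_maps_minus[OF C_module C_module h_lin] h_d_h)
qed

lemma pr_of_h_zero: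
  assumes "x \<in> carrier (C n)" "h n x = \<zero>\<^bsub>C (n + 1)\<^esub>"
  shows "pr n x = x \<ominus>\<^bsub>C n\<^esub> h (n - 1) (d n x)"
  using assms lin_maps_zero[OF C_module C_module d_lin[of "n + 1"]] by (simp add: pr_def)

lemma pr_pr:
  assumes "x \<in> carrier (C n)"
  shows "pr n (pr n x) = pr n x"
proof -
  have "h (n - 1) (d n (pr n x)) = \<zero>\<^bsub>C n\<^esub>"
    using h_pr[of "d n x" "n - 1"] assms by (simp add: d_pr)
  then show ?thesis
    using assms by (simp add: pr_of_h_zero[of "pr n x"] h_pr)
qed

lemma A_carrier: "x \<in> A n \<Longrightarrow> x \<in> carrier (C n)"
  using C.submodule_facts(1)[OF submodule_A] .

text \<open>On the kernel of \<open>h\<close> the map \<open>pr\<close> kills \<open>x - e x\<close>. As that kernel contains the image of \<open>pr\<close>, the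
  maps \<open>e\<close> and \<open>pr\<close> are inverse isomorphisms between the image of \<open>pr\<close> and \<open>A\<close>: see \<open>pr_e_pr\<close> and
  \<open>e_pr\<close> below.\<close>

lemma pr_e:
  assumes "x \<in> carrier (C n)" "h n x = \<zero>\<^bsub>C (n + 1)\<^esub>"
  shows "pr n (e n x) = pr n x"
proof -
  let ?y = "x \<ominus>\<^bsub>C n\<^esub> e n x"
  have "h n ?y = \<zero>\<^bsub>C (n + 1)\<^esub>"
    using assms by (simp add: lin_maps_minus[OF C_module C_module h_lin] h_on_A e_in_A)
  then have "pr n ?y = \<zero>\<^bsub>C n\<^esub>"
    using assms by (simp add: pr_of_h_zero h_d_complement)
  then have "pr n x \<ominus>\<^bsub>C n\<^esub> pr n (e n x) = \<zero>\<^bsub>C n\<^esub>"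
    using assms by (simp add: lin_maps_minus[OF C_module C_module pr_lin])
  then show ?thesis
    using assms minus_eq_zero[of "pr n x" n "pr n (e n x)"] by simp
qed

lemma pr_e_pr: "x \<in> carrier (C n) \<Longrightarrow> pr n (e n (pr n x)) = pr n x"
  by (simp add: pr_e h_pr pr_pr)

lemma pr_e_pr_d:
  assumes "x \<in> carrier (C n)"
  shows "pr (n - 1) (e (n - 1) (pr (n - 1) (d n x))) = d n (pr n x)"
  by (rule trans[OF pr_e_pr[OF lin_mapsD(1)[OF d_lin assms]] d_pr[OF assms]])

lemma e_pr:
  assumes "x \<in> A n"
  shows "e n (pr n x) = x"
proof -
  have x: "x \<in> carrier (C n)"
    using assms by (rule A_carrier)
  have "e n (h (n - 1) (d n x)) = \<zero>\<^bsub>C n\<^esub>"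
    using e_h[of "d n x" "n - 1"] x by simp
  then show ?thesis
    using assms x by (simp add: pr_of_h_zero h_on_A lin_maps_minus[OF C_module C_module e_lin] e_on_A)
qed

abbreviation C\<^sub>A :: "int \<Rightarrow> ('r, 'm) module" where
  "C\<^sub>A n \<equiv> restrict_to (C n) (A n)"

text \<open>The differential of \<open>C\<close> on the image of \<open>pr\<close>, transported to \<open>A\<close> along \<open>e\<close>.\<close>

definition d\<^sub>A :: "int \<Rightarrow> 'm \<Rightarrow> 'm" where
  "d\<^sub>A n x = e (n - 1) (pr (n - 1) (d n x))"

lemma lin_maps_from_A: "f \<in> lin_maps R (C n) N \<Longrightarrow> f \<in> lin_maps R (C\<^sub>A n) N"
  by (auto simp: lin_maps_def A_carrier)

lemma lin_maps_to_A:
  "f \<in> lin_maps R N (C n) \<Longrightarrow> (\<And>x. x \<in> carrier N \<Longrightarrow> f x \<in> A n) \<Longrightarrow> f \<in> lin_maps R N (C\<^sub>A n)"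
  by (auto simp: lin_maps_def)

lemma A_module: "sided_module s R (C\<^sub>A n)"
  by (rule C.sided_module_restrict[OF submodule_A])

lemma chain_complex_A: "chain_complex s R C\<^sub>A d\<^sub>A"
  unfolding chain_complex_def
proof (intro conjI allI ballI)
  fix n
  show "sided_module s R (C\<^sub>A n)"
    by (rule A_module)
  have "d\<^sub>A n \<in> lin_maps R (C n) (C (n - 1))"
    unfolding d\<^sub>A_def by (rule lin_maps_comp[OF lin_maps_comp[OF d_lin pr_lin] e_lin])
  then show "d\<^sub>A n \<in> lin_maps R (C\<^sub>A n) (C\<^sub>A (n - 1))"
    by (intro lin_maps_from_A lin_maps_to_A) (auto simp: d\<^sub>A_def e_in_A A_carrier)
  fix x assume "x \<in> carrier (C\<^sub>A n)"
  then have x: "x \<in> carrier (C n)"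
    by (simp add: A_carrier)
  have "d\<^sub>A (n - 1) (d\<^sub>A n x) = e (n - 2) (pr (n - 2) (d (n - 1) (e (n - 1) (pr (n - 1) (d n x)))))"
    by (simp add: d\<^sub>A_def)
  also have "\<dots> = e (n - 2) (d (n - 1) (pr (n - 1) (e (n - 1) (pr (n - 1) (d n x)))))"
    using d_pr[of "e (n - 1) (pr (n - 1) (d n x))" "n - 1"] x by simp
  also have "\<dots> = e (n - 2) (d (n - 1) (d n (pr n x)))"
    using x by (simp only: pr_e_pr_d)
  also have "\<dots> = \<zero>\<^bsub>C (n - 2)\<^esub>"
    using x by (simp add: d_d)
  finally show "d\<^sub>A (n - 1) (d\<^sub>A n x) = \<zero>\<^bsub>C\<^sub>A (n - 2)\<^esub>"
    by simp
qed

lemma pr_chain_map: "chain_map R C\<^sub>A d\<^sub>A C d pr"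
  unfolding chain_map_def
  by (auto intro: lin_maps_from_A pr_lin simp: d\<^sub>A_def pr_e_pr_d A_carrier)

lemma e_pr_chain_map: "chain_map R C d C\<^sub>A d\<^sub>A (\<lambda>n x. e n (pr n x))"
  unfolding chain_map_def
proof (intro conjI allI ballI)
  fix n
  show "(\<lambda>x. e n (pr n x)) \<in> lin_maps R (C n) (C\<^sub>A n)"
    by (intro lin_maps_to_A lin_maps_comp[OF pr_lin e_lin]) (simp add: e_in_A)
  fix x assume x: "x \<in> carrier (C n)"
  then show "e (n - 1) (pr (n - 1) (d n x)) = d\<^sub>A n (e n (pr n x))"
    using d_pr[of "e n (pr n x)" n] by (simp add: d\<^sub>A_def pr_e_pr d_pr)
qed

lemma homotopy_equivalent_A: "homotopy_equivalent_complexes R C\<^sub>A d\<^sub>A C d"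
  unfolding homotopy_equivalent_complexes_def
proof (intro exI conjI)
  show "chain_map R C\<^sub>A d\<^sub>A C d pr" "chain_map R C d C\<^sub>A d\<^sub>A (\<lambda>n x. e n (pr n x))"
    by (fact pr_chain_map e_pr_chain_map)+
  show "chain_homotopic R C\<^sub>A d\<^sub>A C\<^sub>A d\<^sub>A (\<lambda>n. (\<lambda>x. e n (pr n x)) \<circ> pr n) (\<lambda>n. id)"
    unfolding chain_homotopic_def
    \<comment> \<open>On \<open>A\<close> the composite \<open>e pr pr\<close> is the identity, so the zero homotopy suffices.\<close>
  proof (intro exI[of _ "\<lambda>n x. \<zero>\<^bsub>C (n + 1)\<^esub>"] conjI allI ballI)
    fix n
    show "(\<lambda>x. \<zero>\<^bsub>C (n + 1)\<^esub>) \<in> lin_maps R (C\<^sub>A n) (C\<^sub>A (n + 1))"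
      using lin_maps_const_zero[OF A_module[of "n + 1"]] by simp
    fix x assume x: "x \<in> carrier (C\<^sub>A n)"
    interpret A: sided_module s R "C\<^sub>A n"
      by (rule A_module)
    have "((\<lambda>x. e n (pr n x)) \<circ> pr n) x \<ominus>\<^bsub>C\<^sub>A n\<^esub> id x = \<zero>\<^bsub>C n\<^esub>"
      using x A.M.r_neg[OF x] by (simp add: pr_pr e_pr A_carrier a_minus_def)
    moreover have "d\<^sub>A (n + 1) \<zero>\<^bsub>C (n + 1)\<^esub> = \<zero>\<^bsub>C n\<^esub>"
      using lin_maps_zero[OF C_module C_module d_lin[of "n + 1"]] by (simp add: d\<^sub>A_def)
    ultimately show "((\<lambda>x. e n (pr n x)) \<circ> pr n) x \<ominus>\<^bsub>C\<^sub>A n\<^esub> id x =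
        d\<^sub>A (n + 1) \<zero>\<^bsub>C (n + 1)\<^esub> \<oplus>\<^bsub>C\<^sub>A n\<^esub> \<zero>\<^bsub>C (n - 1 + 1)\<^esub>"
      by simp
  qed
  show "chain_homotopic R C d C d (\<lambda>n. pr n \<circ> (\<lambda>x. e n (pr n x))) (\<lambda>n. id)"
    unfolding chain_homotopic_def
    \<comment> \<open>On \<open>C\<close> the composite \<open>pr e pr\<close> is \<open>pr = 1 - d h - h d\<close>.\<close>
  proof (intro exI[of _ "\<lambda>n x. \<ominus>\<^bsub>C (n + 1)\<^esub> h n x"] conjI allI ballI)
    fix n
    show "(\<lambda>x. \<ominus>\<^bsub>C (n + 1)\<^esub> h n x) \<in> lin_maps R (C n) (C (n + 1))"
      by (rule lin_maps_uminus[OF C_module h_lin])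
    fix x assume x: "x \<in> carrier (C n)"
    have "d (n + 1) (\<ominus>\<^bsub>C (n + 1)\<^esub> h n x) = \<ominus>\<^bsub>C n\<^esub> d (n + 1) (h n x)"
      using lin_maps_a_inv[OF C_module C_module d_lin[of "n + 1"], of "h n x"] x by simp
    moreover have "pr n x \<ominus>\<^bsub>C n\<^esub> x = \<ominus>\<^bsub>C n\<^esub> d (n + 1) (h n x) \<oplus>\<^bsub>C n\<^esub> \<ominus>\<^bsub>C n\<^esub> h (n - 1) (d n x)"
      using x add_minus_cancel[of x n "\<ominus>\<^bsub>C n\<^esub> d (n + 1) (h n x) \<oplus>\<^bsub>C n\<^esub> \<ominus>\<^bsub>C n\<^esub> h (n - 1) (d n x)"]
      by (simp add: pr_def a_minus_def C.M.a_assoc)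
    ultimately show "(pr n \<circ> (\<lambda>x. e n (pr n x))) x \<ominus>\<^bsub>C n\<^esub> id x =
        d (n + 1) (\<ominus>\<^bsub>C (n + 1)\<^esub> h n x) \<oplus>\<^bsub>C n\<^esub> \<ominus>\<^bsub>C (n - 1 + 1)\<^esub> h (n - 1) (d n x)"
      using x by (simp add: pr_e_pr)
  qed
qed

end


section \<open>Morse matchings\<close>

locale morse_complex =
  fixes s :: side
    and R :: "('r, 'q) ring_scheme"
    and C :: "int \<Rightarrow> ('r, 'm) module"
    and d :: "int \<Rightarrow> 'm \<Rightarrow> 'm"
    and I :: "int \<Rightarrow> 'i set"
    and S :: "'i \<Rightarrow> 'm set"
    and M :: "('i \<times> 'i) set"
  assumes based: "based_complex s R C d I S"
    and matching: "morse_matching R C d I S M"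
begin

lemma complex: "chain_complex s R C d"
  and disjoint: "\<alpha> \<in> I m \<Longrightarrow> \<alpha> \<in> I n \<Longrightarrow> m = n"
  and decomposition: "direct_sum_decomposition R (C n) (I n) S"
  using based unfolding based_complex_def by blast+

lemma C_module: "sided_module s R (C n)"
  using complex by (simp add: chain_complex_def)

sublocale C: decomposed_module s R "C n" "I n" S for n
  using C_module decomposition by (simp add: decomposed_module_def decomposed_module_axioms_def)

lemma d_lin: "d (n + 1) \<in> lin_maps R (C (n + 1)) (C n)"
  using complex unfolding chain_complex_def by (metis add_diff_cancel_right')

lemmas d_closed = lin_mapsD(1)[OF d_lin]
lemmas d_zero = lin_maps_zero[OF C_module C_module d_lin]
lemmas component_zero = lin_maps_zero[OF C_module C_module C.component_lin_maps]
lemmas part_zero = lin_maps_zero[OF C_module C_module C.part_lin_maps]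

text \<open>A vertex of degree \<open>n\<close> is a tail if it is the source of an edge of the matching, a head if it is
  the target of one, and critical if it is unmatched.\<close>

definition tails :: "int \<Rightarrow> 'i set" where
  "tails n = {\<alpha> \<in> I n. \<exists>\<beta>. (\<alpha>, \<beta>) \<in> M}"

definition heads :: "int \<Rightarrow> 'i set" where
  "heads n = {\<beta> \<in> I n. \<exists>\<alpha>. (\<alpha>, \<beta>) \<in> M}"

definition critical :: "int \<Rightarrow> 'i set" where
  "critical n = I n \<inter> unmatched I M"

lemma subsets: "tails n \<subseteq> I n" "heads n \<subseteq> I n" "critical n \<subseteq> I n"
  by (auto simp: tails_def heads_def critical_def)

lemma matched_unique:
  assumes "(\<alpha>, \<beta>) \<in> M" "(\<alpha>', \<beta>') \<in> M" "v = \<alpha> \<or> v = \<beta>" "v = \<alpha>' \<or> v = \<beta>'"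
  shows "\<alpha> = \<alpha>'" "\<beta> = \<beta>'"
proof -
  have "\<forall>v. \<forall>e\<in>M. \<forall>e'\<in>M. incident v e \<and> incident v e' \<longrightarrow> e = e'"
    using matching by (simp add: morse_matching_def)
  then have "(\<alpha>, \<beta>) = (\<alpha>', \<beta>')"
    using assms by (metis incident_def fst_conv snd_conv)
  then show "\<alpha> = \<alpha>'" "\<beta> = \<beta>'"
    by auto
qed

lemma matched_degrees:
  assumes "(\<alpha>, \<beta>) \<in> M"
  obtains n where "\<alpha> \<in> I (n + 1)" "\<beta> \<in> I n"
proof -
  have "(\<alpha>, \<beta>) \<in> edges C d I S"
    using assms matching by (auto simp: morse_matching_def)
  then obtain n where "\<alpha> \<in> I n" "\<beta> \<in> I (n - 1)"
    by (auto simp: edges_def)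
  then show ?thesis
    using that[of "n - 1"] by simp
qed

lemma head_of_tail: "(\<alpha>, \<beta>) \<in> M \<Longrightarrow> \<alpha> \<in> I (n + 1) \<Longrightarrow> \<beta> \<in> I n"
  and tail_of_head: "(\<alpha>, \<beta>) \<in> M \<Longrightarrow> \<beta> \<in> I n \<Longrightarrow> \<alpha> \<in> I (n + 1)"
  by (metis matched_degrees disjoint add_right_cancel)+

lemma tails_heads_disjoint: "tails n \<inter> heads n = {}"
proof -
  have False if "(\<alpha>, \<beta>) \<in> M" "(\<gamma>, \<alpha>) \<in> M" for \<alpha> \<beta> \<gamma>
  proof -
    have "\<alpha> = \<beta>"
      using matched_unique(2)[OF that, of \<alpha>] by simp
    then show False
      using matched_degrees[OF that(1)] disjoint by (metis add_cancel_right_right zero_neq_one)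
  qed
  then show ?thesis
    by (auto simp: tails_def heads_def)
qed

lemma critical_iff: "\<alpha> \<in> critical n \<longleftrightarrow> \<alpha> \<in> I n \<and> \<alpha> \<notin> tails n \<and> \<alpha> \<notin> heads n"
  by (fastforce simp: critical_def tails_def heads_def unmatched_def vertices_def incident_def)

lemma matched_iso:
  assumes "(\<alpha>, \<beta>) \<in> M" "\<alpha> \<in> I (n + 1)"
  shows "bij_betw (\<lambda>x. C.component n \<beta> (d (n + 1) x)) (S \<alpha>) (S \<beta>)"
proof -
  have "d_component C d I S (n + 1) \<beta> \<alpha> \<in> lin_isos R (summand C S (n + 1) \<alpha>) (summand C S (n + 1 - 1) \<beta>)"
    using matching assms unfolding morse_matching_def by blast
  then have "bij_betw (d_component C d I S (n + 1) \<beta> \<alpha>) (S \<alpha>) (S \<beta>)"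
    by (simp add: lin_isos_def summand_def)
  then show ?thesis
    by (rule bij_betw_cong[THEN iffD1, rotated]) (simp add: d_component_def)
qed

text \<open>If the component of the differential from \<open>\<alpha>\<close> to \<open>\<beta>\<close> is non-zero and \<open>\<beta>\<close> is matched with a tail
  \<open>\<gamma> \<noteq> \<alpha>\<close>, then \<open>\<alpha> \<rightarrow> \<beta> \<rightarrow> \<gamma>\<close> is a path after reversal of the matching, and \<open>\<gamma>\<close> precedes \<open>\<alpha>\<close>.\<close>

lemma tails_order:
  obtains r where "wf r"
    and "\<And>\<alpha> \<beta> \<gamma> x. \<alpha> \<in> I (n + 1) \<Longrightarrow> x \<in> S \<alpha> \<Longrightarrow> \<beta> \<in> I n \<Longrightarrow>
      C.component n \<beta> (d (n + 1) x) \<noteq> \<zero>\<^bsub>C n\<^esub> \<Longrightarrow> (\<gamma>, \<beta>) \<in> M \<Longrightarrow> \<gamma> \<noteq> \<alpha> \<Longrightarrow> (\<gamma>, \<alpha>) \<in> r"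
proof -
  have "\<exists>r \<subseteq> I (n + 1) \<times> I (n + 1). trans r \<and> wf r \<and>
      (\<forall>\<alpha>\<in>I (n + 1). \<forall>\<gamma>\<in>I (n + 1). \<forall>\<beta>.
        (\<alpha>, \<beta>) \<in> reversed_edges (edges C d I S) M \<and>
        (\<beta>, \<gamma>) \<in> reversed_edges (edges C d I S) M \<longrightarrow> (\<gamma>, \<alpha>) \<in> r)"
    using matching unfolding morse_matching_def by blast
  then obtain r where r: "wf r" "\<And>\<alpha> \<beta> \<gamma>. \<alpha> \<in> I (n + 1) \<Longrightarrow> \<gamma> \<in> I (n + 1) \<Longrightarrow>
      (\<alpha>, \<beta>) \<in> reversed_edges (edges C d I S) M \<Longrightarrow>
      (\<beta>, \<gamma>) \<in> reversed_edges (edges C d I S) M \<Longrightarrow> (\<gamma>, \<alpha>) \<in> r"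
    by blast
  show ?thesis
  proof (rule that[OF r(1)])
    fix \<alpha> \<beta> \<gamma> x
    assume *: "\<alpha> \<in> I (n + 1)" "x \<in> S \<alpha>" "\<beta> \<in> I n" "C.component n \<beta> (d (n + 1) x) \<noteq> \<zero>\<^bsub>C n\<^esub>"
      "(\<gamma>, \<beta>) \<in> M" "\<gamma> \<noteq> \<alpha>"
    have "d_component C d I S (n + 1) \<beta> \<alpha> x \<noteq> \<zero>\<^bsub>C (n + 1 - 1)\<^esub>"
      using * by (simp add: d_component_def)
    then have "(\<alpha>, \<beta>) \<in> edges C d I S"
      unfolding edges_def using * by (auto intro!: exI[of _ "n + 1"] bexI[of _ x])
    moreover have "(\<alpha>, \<beta>) \<notin> M"
      using matched_unique(1)[OF *(5), of \<alpha> \<beta> \<beta>] *(6) by auto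
    ultimately show "(\<gamma>, \<alpha>) \<in> r"
      using * r(2)[of \<alpha> \<gamma> \<beta>] tail_of_head by (auto simp: reversed_edges_def)
  qed
qed

lemma pd_lin: "(\<lambda>x. C.part n (heads n) (d (n + 1) x)) \<in> lin_maps R (C (n + 1)) (C n)"
  by (rule lin_maps_comp[OF d_lin C.part_lin_maps])

text \<open>The sum of the tail summands of degree \<open>n\<close>.\<close>

abbreviation C_tails :: "int \<Rightarrow> 'm set" where
  "C_tails n \<equiv> carrier (partial_sum (C n) (tails n) S)"

lemma C_tails_iff:
  "x \<in> C_tails n \<longleftrightarrow> x \<in> carrier (C n) \<and> (\<forall>\<alpha>. \<alpha> \<notin> tails n \<longrightarrow> C.component n \<alpha> x = \<zero>\<^bsub>C n\<^esub>)"
  using C.partial_sum_carrier[OF subsets(1)] by auto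

lemmas C_tails_facts = C.submodule_facts[OF C.partial_sum_submodule[OF subsets(1)]]

text \<open>The next two lemmas say that the block of the differential from the tails to the heads is
  bijective. For injectivity, look at a maximal tail \<open>\<alpha>\<close> in the support of an element of the kernel:
  only \<open>\<alpha>\<close> itself contributes to the component at the head matched with \<open>\<alpha>\<close>.\<close>

lemma tails_to_heads_injective:
  assumes x: "x \<in> C_tails (n + 1)" and zero: "C.part n (heads n) (d (n + 1) x) = \<zero>\<^bsub>C n\<^esub>"
  shows "x = \<zero>\<^bsub>C (n + 1)\<^esub>"
proof (rule ccontr)
  assume x_nonzero: "x \<noteq> \<zero>\<^bsub>C (n + 1)\<^esub>"
  obtain r where r: "wf r"
    "\<And>\<alpha> \<beta> \<gamma> x. \<alpha> \<in> I (n + 1) \<Longrightarrow> x \<in> S \<alpha> \<Longrightarrow> \<beta> \<in> I n \<Longrightarrow>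
      C.component n \<beta> (d (n + 1) x) \<noteq> \<zero>\<^bsub>C n\<^esub> \<Longrightarrow> (\<gamma>, \<beta>) \<in> M \<Longrightarrow> \<gamma> \<noteq> \<alpha> \<Longrightarrow> (\<gamma>, \<alpha>) \<in> r"
    using tails_order[of n] by metis
  have xC: "x \<in> carrier (C (n + 1))"
    using x by (simp add: C_tails_iff)
  define F where "F = {\<alpha>. C.component (n + 1) \<alpha> x \<noteq> \<zero>\<^bsub>C (n + 1)\<^esub>}"
  have "finite F"
    unfolding F_def by (rule C.component_finite[OF xC])
  have "F \<noteq> {}"
    using x_nonzero C.component_eqI[OF xC C.M.zero_closed] component_zero by (auto simp: F_def)
  \<comment> \<open>A well-founded relation is also conversely well-founded on a finite set.\<close>
  have "wf ((r \<inter> F \<times> F)\<inverse>)"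
    using \<open>finite F\<close> r(1) by (intro finite_acyclic_wf_converse wf_acyclic) (auto intro: wf_subset)
  then have "\<exists>\<alpha>\<in>F. \<forall>\<gamma>\<in>F. (\<alpha>, \<gamma>) \<notin> r"
    using \<open>F \<noteq> {}\<close>
  proof (rule wfE_min')
    fix \<alpha> assume \<alpha>: "\<alpha> \<in> F" and min: "\<And>\<gamma>. (\<gamma>, \<alpha>) \<in> (r \<inter> F \<times> F)\<inverse> \<Longrightarrow> \<gamma> \<notin> F"
    have "(\<alpha>, \<gamma>) \<notin> r" if "\<gamma> \<in> F" for \<gamma>
      using min[of \<gamma>] that \<alpha> by blast
    then show ?thesis
      using \<alpha> by (intro bexI ballI)
  qed
  then obtain \<alpha> where \<alpha>: "\<alpha> \<in> F" "\<And>\<gamma>. \<gamma> \<in> F \<Longrightarrow> (\<alpha>, \<gamma>) \<notin> r"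
    by auto
  then have "\<alpha> \<in> tails (n + 1)"
    using x by (auto simp: F_def C_tails_iff)
  then obtain \<beta> where \<beta>: "(\<alpha>, \<beta>) \<in> M" and \<alpha>I: "\<alpha> \<in> I (n + 1)"
    by (auto simp: tails_def)
  have \<beta>I: "\<beta> \<in> I n"
    by (rule head_of_tail[OF \<beta> \<alpha>I])
  let ?f = "\<lambda>z. C.component n \<beta> (d (n + 1) z)"
  let ?y = "C.part (n + 1) (- {\<alpha>}) x"
  have f_lin: "?f \<in> lin_maps R (C (n + 1)) (C n)"
    by (rule lin_maps_comp[OF d_lin C.component_lin_maps])
  note f_zero = lin_maps_zero[OF C_module C_module f_lin]
  have "?f ?y = \<zero>\<^bsub>C n\<^esub>"
  proof (rule C.component_induct[where P = "\<lambda>z. ?f z = \<zero>\<^bsub>C n\<^esub>"])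
    fix \<gamma> assume \<gamma>: "\<gamma> \<in> I (n + 1)"
    show "?f (C.component (n + 1) \<gamma> ?y) = \<zero>\<^bsub>C n\<^esub>"
    proof (cases "\<gamma> = \<alpha> \<or> \<gamma> \<notin> F")
      case True
      then show ?thesis
        using xC f_zero by (auto simp: C.component_part F_def)
    next
      case False
      then show ?thesis
        using xC \<alpha>(2)[of \<gamma>] r(2)[OF \<gamma> C.component_in_S[OF xC \<gamma>] \<beta>I _ \<beta>] by (auto simp: C.component_part)
    qed
  qed (use xC f_zero lin_mapsD(2)[OF f_lin] in \<open>auto simp: C.part_carrier\<close>)
  moreover have "?f x = ?f (C.component (n + 1) \<alpha> x) \<oplus>\<^bsub>C n\<^esub> ?f ?y"
    by (rule trans[OF arg_cong[OF C.split_component[OF \<alpha>I xC], of ?f]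
          lin_mapsD(2)[OF f_lin C.component_carrier[OF xC] C.part_carrier[OF xC]]])
  moreover have "?f x = \<zero>\<^bsub>C n\<^esub>"
    using zero \<beta> \<beta>I C.part_eq_zero_iff[OF d_closed[OF xC]] by (auto simp: heads_def)
  ultimately have "?f (C.component (n + 1) \<alpha> x) = ?f \<zero>\<^bsub>C (n + 1)\<^esub>"
    using lin_mapsD(1)[OF f_lin C.component_carrier[OF xC]] f_zero by simp
  then have "C.component (n + 1) \<alpha> x = \<zero>\<^bsub>C (n + 1)\<^esub>"
    using matched_iso[OF \<beta> \<alpha>I] C.component_in_S[OF xC \<alpha>I] C.S_facts(2)[OF \<alpha>I]
    unfolding bij_betw_def inj_on_def by blast
  then show False
    using \<alpha>(1) by (simp add: F_def)
qed

text \<open>Surjectivity is by well-founded induction on tails: an element of the summand of the head matched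
  with \<open>\<alpha>\<close> is hit by an element of the summand of \<open>\<alpha>\<close>, up to components at heads matched with tails
  that precede \<open>\<alpha>\<close>.\<close>

lemma tails_to_heads_surjective:
  assumes "y \<in> carrier (C n)"
  shows "\<exists>x\<in>C_tails (n + 1). C.part n (heads n) (d (n + 1) x) = C.part n (heads n) y"
proof -
  let ?p = "C.part n (heads n)"
  \<comment> \<open>\<open>P y\<close>: the part of \<open>y\<close> at the heads is in the image of the block.\<close>
  define P where "P y \<longleftrightarrow> (\<exists>x\<in>C_tails (n + 1). ?p (d (n + 1) x) = ?p y)" for y
  have P_zero: "P y" if "?p y = \<zero>\<^bsub>C n\<^esub>" for y
    using that lin_maps_zero[OF C_module C_module pd_lin] C_tails_facts(2) by (force simp: P_def)
  have P_add: "P (y \<oplus>\<^bsub>C n\<^esub> z)" if "y \<in> carrier (C n)" "z \<in> carrier (C n)" "P y" "P z" for y z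
  proof -
    obtain x x' where x: "x \<in> C_tails (n + 1)" "?p (d (n + 1) x) = ?p y"
      and x': "x' \<in> C_tails (n + 1)" "?p (d (n + 1) x') = ?p z"
      using \<open>P y\<close> \<open>P z\<close> unfolding P_def by blast
    then have "?p (d (n + 1) (x \<oplus>\<^bsub>C (n + 1)\<^esub> x')) = ?p (y \<oplus>\<^bsub>C n\<^esub> z)"
      using that lin_mapsD(2)[OF pd_lin] C_tails_facts(1) lin_mapsD(2)[OF C.part_lin_maps] by simp
    then show ?thesis
      unfolding P_def using C_tails_facts(3)[OF x(1) x'(1)] by blast
  qed
  have P_inv: "P (\<ominus>\<^bsub>C n\<^esub> y)" if "y \<in> carrier (C n)" "P y" for y
  proof -
    obtain x where x: "x \<in> C_tails (n + 1)" "?p (d (n + 1) x) = ?p y"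
      using \<open>P y\<close> unfolding P_def by blast
    then have "?p (d (n + 1) (\<ominus>\<^bsub>C (n + 1)\<^esub> x)) = ?p (\<ominus>\<^bsub>C n\<^esub> y)"
      using that lin_maps_a_inv[OF C_module C_module pd_lin] C_tails_facts(1)
        lin_maps_a_inv[OF C_module C_module C.part_lin_maps] by simp
    then show ?thesis
      unfolding P_def using C_tails_facts(5)[OF x(1)] by blast
  qed
  obtain r where r: "wf r"
    "\<And>\<alpha> \<beta> \<gamma> x. \<alpha> \<in> I (n + 1) \<Longrightarrow> x \<in> S \<alpha> \<Longrightarrow> \<beta> \<in> I n \<Longrightarrow>
      C.component n \<beta> (d (n + 1) x) \<noteq> \<zero>\<^bsub>C n\<^esub> \<Longrightarrow> (\<gamma>, \<beta>) \<in> M \<Longrightarrow> \<gamma> \<noteq> \<alpha> \<Longrightarrow> (\<gamma>, \<alpha>) \<in> r"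
    using tails_order[of n] by metis
  have zero: "P \<zero>\<^bsub>C n\<^esub>"
    by (rule P_zero[OF part_zero])
  have not_head: "P w" if "\<beta> \<in> I n" "\<beta> \<notin> heads n" "w \<in> S \<beta>" for \<beta> w
    using that C.S_facts(1)[OF that(1,3)]
    by (intro P_zero) (auto simp: C.part_eq_zero_iff C.component_single[OF that(1,3)])
  have head: "P w" if "(\<alpha>, \<beta>) \<in> M" "\<beta> \<in> I n" "w \<in> S \<beta>" for \<alpha> \<beta> w
    using that
  proof (induction \<alpha> arbitrary: \<beta> w rule: wf_induct_rule[OF r(1)])
    case (1 \<alpha>)
    have \<alpha>I: "\<alpha> \<in> I (n + 1)"
      by (rule tail_of_head[OF 1(2,3)])
    have "w \<in> (\<lambda>x. C.component n \<beta> (d (n + 1) x)) ` S \<alpha>"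
      using bij_betw_imp_surj_on[OF matched_iso[OF 1(2) \<alpha>I]] 1(4) by simp
    then obtain x where x: "x \<in> S \<alpha>" "C.component n \<beta> (d (n + 1) x) = w"
      by (elim imageE) simp
    let ?y = "d (n + 1) x"
    have y: "?y \<in> carrier (C n)"
      by (rule d_closed[OF C.S_facts(1)[OF \<alpha>I x(1)]])
    let ?z = "C.part n (- {\<beta>}) ?y"
    have z: "?z \<in> carrier (C n)"
      by (rule C.part_carrier[OF y])
    have "x \<in> C_tails (n + 1)"
      using 1(2) \<alpha>I x(1) by (intro C.S_in_partial_sum subsets) (auto simp: tails_def)
    then have "P ?y"
      by (auto simp: P_def)
    moreover have "P ?z"
    proof (rule C.component_induct[OF z _ zero P_add])
      fix \<beta>' assume \<beta>': "\<beta>' \<in> I n"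
      have in_S: "C.component n \<beta>' ?y \<in> S \<beta>'"
        by (rule C.component_in_S[OF y \<beta>'])
      consider "\<beta>' = \<beta> \<or> C.component n \<beta>' ?y = \<zero>\<^bsub>C n\<^esub>" | "\<beta>' \<notin> heads n" "\<beta>' \<noteq> \<beta>"
        | "\<beta>' \<in> heads n" "\<beta>' \<noteq> \<beta>" "C.component n \<beta>' ?y \<noteq> \<zero>\<^bsub>C n\<^esub>"
        by blast
      then show "P (C.component n \<beta>' ?z)"
      proof cases
        case 1
        then show ?thesis
          using y zero by (auto simp: C.component_part)
      next
        case 2
        then show ?thesis
          using y not_head[OF \<beta>' _ in_S] by (simp add: C.component_part)
      next
        case 3
        then obtain \<gamma> where \<gamma>: "(\<gamma>, \<beta>') \<in> M"
          by (auto simp: heads_def)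
        then have "\<gamma> \<noteq> \<alpha>"
          using matched_unique(2)[OF \<gamma> 1(2), of \<gamma>] 3(2) by blast
        then have "(\<gamma>, \<alpha>) \<in> r"
          by (rule r(2)[OF \<alpha>I x(1) \<beta>' 3(3) \<gamma>])
        then show ?thesis
          using 1(1)[OF _ \<gamma> \<beta>' in_S] y 3(2) by (simp add: C.component_part)
      qed
    qed
    moreover have "w = ?y \<oplus>\<^bsub>C n\<^esub> \<ominus>\<^bsub>C n\<^esub> ?z"
    proof -
      have w: "w \<in> carrier (C n)"
        using C.component_carrier[OF y] x(2) by blast
      have "?y = w \<oplus>\<^bsub>C n\<^esub> ?z"
        using C.split_component[OF 1(3) y] unfolding x(2) .
      then have "?y \<oplus>\<^bsub>C n\<^esub> \<ominus>\<^bsub>C n\<^esub> ?z = (w \<oplus>\<^bsub>C n\<^esub> ?z) \<oplus>\<^bsub>C n\<^esub> \<ominus>\<^bsub>C n\<^esub> ?z"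
        by (rule arg_cong)
      also have "\<dots> = w"
        using w z by (simp add: C.M.a_assoc C.M.r_neg)
      finally show ?thesis
        by (rule sym)
    qed
    ultimately show ?case
      using P_add[OF y _ _ P_inv] z by simp
  qed
  have "P y"
  proof (rule C.component_induct[OF assms _ zero P_add])
    fix \<beta> assume "\<beta> \<in> I n"
    then show "P (C.component n \<beta> y)"
      using head not_head C.component_in_S[OF assms] by (cases "\<beta> \<in> heads n") (auto simp: heads_def)
  qed
  then show ?thesis
    by (simp add: P_def)
qed

text \<open>The inverse of the tails-to-heads block, extended by zero to the summands that are not heads. The
  description determines \<open>h n x\<close> because the block is bijective.\<close>

definition h :: "int \<Rightarrow> 'm \<Rightarrow> 'm" where
  "h n x = (THE z. z \<in> C_tails (n + 1) \<and> C.part n (heads n) (d (n + 1) z) = C.part n (heads n) x)"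

lemma h_unique:
  assumes "z \<in> C_tails (n + 1)" "C.part n (heads n) (d (n + 1) z) = C.part n (heads n) x"
  shows "h n x = z"
  unfolding h_def
proof (rule the_equality)
  fix y assume y: "y \<in> C_tails (n + 1) \<and> C.part n (heads n) (d (n + 1) y) = C.part n (heads n) x"
  have yz: "y \<in> carrier (C (n + 1))" "z \<in> carrier (C (n + 1))"
    using y assms(1) C_tails_facts(1) by blast+
  have "C.part n (heads n) (d (n + 1) (y \<ominus>\<^bsub>C (n + 1)\<^esub> z)) = \<zero>\<^bsub>C n\<^esub>"
    using lin_maps_minus[OF C_module C_module pd_lin yz] assms(2) y lin_mapsD(1)[OF pd_lin yz(2)]
    by (simp add: a_minus_def C.M.r_neg)
  moreover have "y \<ominus>\<^bsub>C (n + 1)\<^esub> z \<in> C_tails (n + 1)"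
    using y assms(1) unfolding a_minus_def by (intro C_tails_facts) auto
  ultimately have "y \<ominus>\<^bsub>C (n + 1)\<^esub> z = \<zero>\<^bsub>C (n + 1)\<^esub>"
    by (rule tails_to_heads_injective[rotated])
  then show "y = z"
    using yz C.M.minus_equality[of "n + 1" y "\<ominus>\<^bsub>C (n + 1)\<^esub> z"] by (simp add: a_minus_def)
qed (use assms in auto)

lemma
  assumes "x \<in> carrier (C n)"
  shows h_in: "h n x \<in> C_tails (n + 1)"
    and part_d_h: "C.part n (heads n) (d (n + 1) (h n x)) = C.part n (heads n) x"
proof -
  obtain z where z: "z \<in> C_tails (n + 1)" "C.part n (heads n) (d (n + 1) z) = C.part n (heads n) x"
    using tails_to_heads_surjective[OF assms] by blast
  then show "h n x \<in> C_tails (n + 1)" "C.part n (heads n) (d (n + 1) (h n x)) = C.part n (heads n) x"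
    using h_unique[OF z] by simp_all
qed

lemma h_zero: "C.part n (heads n) x = \<zero>\<^bsub>C n\<^esub> \<Longrightarrow> h n x = \<zero>\<^bsub>C (n + 1)\<^esub>"
  by (rule h_unique) (simp_all add: C_tails_facts(2) d_zero part_zero)

lemma h_lin: "h n \<in> lin_maps R (C n) (C (n + 1))"
proof (rule lin_mapsI)
  note carrier = C_tails_facts(1)[OF h_in]
  show "h n x \<in> carrier (C (n + 1))" if "x \<in> carrier (C n)" for x
    by (rule carrier[OF that])
  show "h n (x \<oplus>\<^bsub>C n\<^esub> y) = h n x \<oplus>\<^bsub>C (n + 1)\<^esub> h n y"
    if "x \<in> carrier (C n)" "y \<in> carrier (C n)" for x y
    by (rule h_unique)
      (use that in \<open>simp_all add: C_tails_facts(3) h_in carrier lin_mapsD(2)[OF pd_lin] part_d_h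
        lin_mapsD(2)[OF C.part_lin_maps]\<close>)
  show "h n (a \<odot>\<^bsub>C n\<^esub> x) = a \<odot>\<^bsub>C (n + 1)\<^esub> h n x"
    if "a \<in> carrier R" "x \<in> carrier (C n)" for a x
    by (rule h_unique)
      (use that in \<open>simp_all add: C_tails_facts(4) h_in carrier lin_mapsD(3)[OF pd_lin] part_d_h
        lin_mapsD(3)[OF C.part_lin_maps]\<close>)
qed

lemma part_C_tails:
  assumes "x \<in> C_tails n" "K \<inter> tails n = {}"
  shows "C.part n K x = \<zero>\<^bsub>C n\<^esub>"
  using assms by (subst C.part_eq_zero_iff) (auto simp: C_tails_iff)

text \<open>The map \<open>h\<close> contracts \<open>C\<close> onto the critical summands, because it depends only on the components at
  heads and its values have components at tails only.\<close>

sublocale reduction: contraction s R C d h "\<lambda>n. C.part n (critical n)"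
  "\<lambda>n. carrier (partial_sum (C n) (critical n) S)"
proof (rule contraction.intro, goal_cases)
  case 1
  show ?case by (rule complex)
next
  case (2 n)
  show ?case by (rule C.partial_sum_submodule[OF subsets(3)])
next
  case (3 n)
  show ?case by (rule h_lin)
next
  case (4 n)
  show ?case by (rule C.part_lin_maps)
next
  case (5 x n)
  then show ?case by (rule C.part_in_partial_sum[OF subsets(3)])
next
  case (6 x n)
  then show ?case by (rule C.part_id[OF subsets(3)])
next
  case (7 x n)
  have "C.part (n + 1) (heads (n + 1)) (h n x) = \<zero>\<^bsub>C (n + 1)\<^esub>"
    using h_in[OF 7] tails_heads_disjoint[of "n + 1"] by (intro part_C_tails) auto
  then show ?case
    using h_zero[of "n + 1" "h n x"] by (simp add: add.assoc)
next
  case (8 x n)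
  then show ?case
    by (intro h_unique h_in refl)
next
  case (9 x n)
  then have "x \<in> carrier (C n)" "\<forall>\<alpha>\<in>heads n. C.component n \<alpha> x = \<zero>\<^bsub>C n\<^esub>"
    by (auto simp: C.partial_sum_carrier[OF subsets(3)] critical_iff)
  then show ?case
    by (intro h_zero) (simp add: C.part_eq_zero_iff)
next
  case (10 x n)
  show ?case
    using h_in[OF 10] by (rule part_C_tails) (auto simp: critical_iff)
next
  case (11 x n)
  let ?y = "x \<ominus>\<^bsub>C n\<^esub> C.part n (critical n) x"
  \<comment> \<open>The kernel of \<open>h\<close> has no components at heads, so removal of the critical components leaves an
    element supported on the tails, on which \<open>h d\<close> is the identity.\<close>
  have "C.part n (heads n) x = \<zero>\<^bsub>C n\<^esub>"
    using part_d_h[OF 11(1)] 11(2) by (simp add: d_zero part_zero)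
  then have heads: "C.component n \<alpha> x = \<zero>\<^bsub>C n\<^esub>" if "\<alpha> \<in> heads n" for \<alpha>
    using that 11(1) by (simp add: C.part_eq_zero_iff)
  have "C.component n \<alpha> ?y = \<zero>\<^bsub>C n\<^esub>" if "\<alpha> \<notin> tails n" for \<alpha>
  proof -
    have "C.component n \<alpha> ?y = C.component n \<alpha> x \<ominus>\<^bsub>C n\<^esub> C.component n \<alpha> (C.part n (critical n) x)"
      using 11(1) by (intro lin_maps_minus[OF C_module C_module C.component_lin_maps] C.part_carrier)
    then show ?thesis
      using that 11(1) heads[of \<alpha>] C.component_outside[OF 11(1), of \<alpha>] C.component_carrier[OF 11(1), of \<alpha>]
      by (auto simp: C.component_part critical_iff a_minus_def C.M.r_neg)
  qed
  then have "?y \<in> C_tails n"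
    using 11(1) by (simp add: C_tails_iff C.part_carrier)
  then show ?case
    using h_unique[of ?y "n - 1" "d n ?y"] by simp
qed

end

theorem theorem2:
  fixes s :: side
    and R :: "('r, 'q) ring_scheme"
    and C :: "int \<Rightarrow> ('r, 'm) module"
    and d :: "int \<Rightarrow> 'm \<Rightarrow> 'm"
    and I :: "int \<Rightarrow> 'i set"
    and S :: "'i \<Rightarrow> 'm set"
    and M :: "('i \<times> 'i) set"
  assumes "ring R"
    and "based_complex s R C d I S"
    and "morse_matching R C d I S M"
  defines "C\<^sub>0 \<equiv> \<lambda>n. partial_sum (C n) (I n \<inter> unmatched I M) S"
  shows "\<exists>d\<^sub>0. chain_complex s R C\<^sub>0 d\<^sub>0 \<and> homotopy_equivalent_complexes R C\<^sub>0 d\<^sub>0 C d"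
proof -
  interpret morse_complex s R C d I S M
    using assms(2,3) by unfold_locales
  have "reduction.C\<^sub>A = C\<^sub>0"
    by (auto simp: C\<^sub>0_def partial_sum_def critical_def)
  then show ?thesis
    using reduction.chain_complex_A reduction.homotopy_equivalent_A by auto
qed

end
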